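(* Let $(T_i)_{i=1}^{\infty}$ be a sequence of bounded linear operators from a normed linear space $X$ to a normed linear space $Y$. Then the following assertions are equivalent: (1) $(T_i)_{i}$ is mean Li-Yorke chaotic; (2) there exists a mean Li-Yorke pair for $(T_i)_i$; (3) there exists an absolutely mean semi-irregular vector for $(T_i)_i$.
   Context: Normed spaces are over $\mathbb{K}=\mathbb{R}$ or $\mathbb{C}$. For a sequence $(T_i)_{i=1}^\infty$ of bounded linear operators from a normed linear space $X$ to a normed linear space $Y$: a pair $(x,y)\in X\times X$ is a \emph{mean Li-Yorke pair} if $\liminf_{n\to\infty}\frac1n\sum_{i=1}^n\Vert T_ix-T_iy\Vert=0$ and $\limsup_{n\to\infty}\frac1n\sum_{i=1}^n\Vert T_ix-T_iy\Vert>0$. A subset $K\subset X$ is \emph{mean Li-Yorke scrambled} if any two distinct points of $K$ form a mean Li-Yorke pair. $(T_i)_i$ is \emph{mean Li-Yorke chaotic} if there exists an uncountable mean Li-Yorke scrambled subset of $X$. A vector $x\in X$ is \emph{absolutely mean semi-irregular} if $\liminf_{n\to\infty}\frac1n\sum_{i=1}^n\Vert T_ix\Vert=0$ and $\limsup_{n\to\infty}\frac1n\sum_{i=1}^n\Vert T_ix\Vert>0$. *)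

theory Defs
  imports "HOL-Analysis.Analysis"
begin

text \<open>
  Normed spaces over the scalar field \<open>'k\<close>. By the Gelfand--Mazur theorem the types of class
  \<open>real_normed_field\<close>, whose norm is multiplicative, are up to isometric isomorphism
  exactly the real and the complex numbers. The class \<open>real_normed_vector\<close> supplies
  the norm, and \<open>scale_of_real\<close> says that its real scalar multiplication is the
  restriction of \<open>scale\<close>.
\<close>

locale normed_space_over = vector_space scale
  for scale :: "'k::real_normed_field \<Rightarrow> 'a::real_normed_vector \<Rightarrow> 'a" +
  assumes scale_of_real: "scale (of_real r) x = r *\<^sub>R x"
    and norm_scale: "norm (scale c x) = norm c * norm x"

locale bounded_linear_over = Vector_Spaces.linear scaleX scaleY f
  for scaleX :: "'k::real_normed_field \<Rightarrow> 'a::real_normed_vector \<Rightarrow> 'a"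
    and scaleY :: "'k \<Rightarrow> 'b::real_normed_vector \<Rightarrow> 'b"
    and f :: "'a \<Rightarrow> 'b" +
  assumes bounded: "\<exists>B. \<forall>x. norm (f x) \<le> norm x * B"

lemma normed_space_over_scaleR:
  "normed_space_over (scaleR :: real \<Rightarrow> 'a::real_normed_vector \<Rightarrow> 'a)"
  by unfold_locales (auto simp: algebra_simps)

lemma bounded_linear_over_scaleR_iff:
  fixes f :: "'a::real_normed_vector \<Rightarrow> 'b::real_normed_vector"
  shows "bounded_linear_over scaleR scaleR f \<longleftrightarrow> bounded_linear f"
  unfolding bounded_linear_over_def bounded_linear_over_axioms_def
    bounded_linear_def bounded_linear_axioms_def linear_def by simp

lemma normed_space_over_mult:
  "normed_space_over ((*) :: complex \<Rightarrow> complex \<Rightarrow> complex)"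
  by unfold_locales (auto simp: algebra_simps norm_mult scaleR_conv_of_real)

text \<open>
  The sequences are indexed from 1, so \<open>T 0\<close> plays no role. Lower and upper limits are
  taken in the extended reals because the averages may be unbounded.
\<close>

definition mean_Li_Yorke_pair ::
  "(nat \<Rightarrow> 'a \<Rightarrow> 'b::real_normed_vector) \<Rightarrow> 'a \<Rightarrow> 'a \<Rightarrow> bool" where
  "mean_Li_Yorke_pair T x y \<longleftrightarrow>
     liminf (\<lambda>n. ereal (1 / real n * (\<Sum>i=1..n. norm (T i x - T i y)))) = 0 \<and>
     limsup (\<lambda>n. ereal (1 / real n * (\<Sum>i=1..n. norm (T i x - T i y)))) > 0"

definition mean_Li_Yorke_scrambled ::
  "(nat \<Rightarrow> 'a \<Rightarrow> 'b::real_normed_vector) \<Rightarrow> 'a set \<Rightarrow> bool" where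
  "mean_Li_Yorke_scrambled T K \<longleftrightarrow>
     (\<forall>x\<in>K. \<forall>y\<in>K. x \<noteq> y \<longrightarrow> mean_Li_Yorke_pair T x y)"

definition mean_Li_Yorke_chaotic ::
  "(nat \<Rightarrow> 'a \<Rightarrow> 'b::real_normed_vector) \<Rightarrow> bool" where
  "mean_Li_Yorke_chaotic T \<longleftrightarrow> (\<exists>K. uncountable K \<and> mean_Li_Yorke_scrambled T K)"

definition absolutely_mean_semi_irregular ::
  "(nat \<Rightarrow> 'a \<Rightarrow> 'b::real_normed_vector) \<Rightarrow> 'a \<Rightarrow> bool" where
  "absolutely_mean_semi_irregular T x \<longleftrightarrow>
     liminf (\<lambda>n. ereal (1 / real n * (\<Sum>i=1..n. norm (T i x)))) = 0 \<and>
     limsup (\<lambda>n. ereal (1 / real n * (\<Sum>i=1..n. norm (T i x)))) > 0"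

end

theory Submission
  imports Defs
begin

text \<open>By linearity, (x, y) is a mean Li-Yorke pair exactly when x - y is absolutely mean
  semi-irregular (\<open>mean_Li_Yorke_pair_iff_diff\<close>), and semi-irregularity survives
  multiplication by any nonzero real (\<open>absolutely_mean_semi_irregular_scaleR\<close>). Hence
  the real line spanned by one semi-irregular vector is scrambled: differences of its distinct
  points are nonzero multiples of that vector. The line is uncountable, which gives chaos.
  Conversely, an uncountable scrambled set has two distinct points, and these form a pair.\<close>

lemma mean_Li_Yorke_pair_iff_diff:
  assumes "\<And>i. i \<ge> 1 \<Longrightarrow> T i (x - y) = T i x - T i y"
  shows "mean_Li_Yorke_pair T x y \<longleftrightarrow> absolutely_mean_semi_irregular T (x - y)"
proof -
  have "(\<Sum>i=1..n. norm (T i x - T i y)) = (\<Sum>i=1..n. norm (T i (x - y)))" for n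
    by (rule sum.cong) (simp_all add: assms)
  then show ?thesis
    unfolding mean_Li_Yorke_pair_def absolutely_mean_semi_irregular_def by presburger
qed

text \<open>Every average is multiplied by the same factor |c| > 0, so a zero lower limit stays zero
  and a positive upper limit, finite or infinite, stays positive.\<close>

lemma absolutely_mean_semi_irregular_scaleR:
  fixes T :: "nat \<Rightarrow> 'a::real_normed_vector \<Rightarrow> 'b::real_normed_vector"
  assumes scale: "\<And>i. i \<ge> 1 \<Longrightarrow> T i (c *\<^sub>R x) = c *\<^sub>R T i x"
    and "c \<noteq> 0" and x: "absolutely_mean_semi_irregular T x"
  shows "absolutely_mean_semi_irregular T (c *\<^sub>R x)"
proof -
  let ?m = "\<lambda>z n. ereal (1 / real n * (\<Sum>i=1..n. norm (T i z)))"
  have "(\<Sum>i=1..n. norm (T i (c *\<^sub>R x))) = \<bar>c\<bar> * (\<Sum>i=1..n. norm (T i x))" for n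
    unfolding sum_distrib_left by (rule sum.cong) (simp_all add: scale)
  then have m: "?m (c *\<^sub>R x) = (\<lambda>n. ereal \<bar>c\<bar> * ?m x n)"
    by (simp add: fun_eq_iff)
  show ?thesis
    using x \<open>c \<noteq> 0\<close> unfolding absolutely_mean_semi_irregular_def m
    \<comment> \<open>The finite nonnegative factor |c| is pulled out of both limits; the remaining
      claim is that a product of two positive extended reals is positive.\<close>
    by (simp only: Liminf_ereal_mult_left Limsup_ereal_mult_left trivial_limit_sequentially
          abs_ge_zero not_False_eq_True mult_zero_right) (simp add: ereal_zero_less_0_iff)
qed

theorem proposition3p6:
  fixes scaleX :: "'k::real_normed_field \<Rightarrow> 'a::real_normed_vector \<Rightarrow> 'a"
    and scaleY :: "'k \<Rightarrow> 'b::real_normed_vector \<Rightarrow> 'b"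
    and T :: "nat \<Rightarrow> 'a \<Rightarrow> 'b"
  assumes "normed_space_over scaleX"
    and "normed_space_over scaleY"
    and "\<And>i. i \<ge> 1 \<Longrightarrow> bounded_linear_over scaleX scaleY (T i)"
  shows "(mean_Li_Yorke_chaotic T \<longleftrightarrow> (\<exists>x y. mean_Li_Yorke_pair T x y)) \<and>
         ((\<exists>x y. mean_Li_Yorke_pair T x y) \<longleftrightarrow> (\<exists>x. absolutely_mean_semi_irregular T x))"
proof -
  have linear: "linear (T i)" if "i \<ge> 1" for i
  proof
    interpret T: bounded_linear_over scaleX scaleY "T i"
      using that by (rule assms(3))
    show "T i (x + y) = T i x + T i y" for x y
      by (rule T.add)
    show "T i (r *\<^sub>R x) = r *\<^sub>R T i x" for r x
      \<comment> \<open>A real scalar acts as its image in the field, so homogeneity over the field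
        gives real homogeneity.\<close>
      using T.scale[of "of_real r" x] by (simp add: assms(1,2)[THEN normed_space_over.scale_of_real])
  qed
  have pair_iff: "mean_Li_Yorke_pair T x y \<longleftrightarrow> absolutely_mean_semi_irregular T (x - y)" for x y
    by (rule mean_Li_Yorke_pair_iff_diff) (rule linear_diff[OF linear])
  have "mean_Li_Yorke_chaotic T" if x: "absolutely_mean_semi_irregular T x" for x
  proof -
    \<comment> \<open>Real multiples suffice for complex scalars too: they already form an
      uncountable set.\<close>
    let ?K = "range (\<lambda>r::real. r *\<^sub>R x)"
    \<comment> \<open>At the zero vector all averages vanish, contradicting the positive upper
      limit.\<close>
    have "x \<noteq> 0"
    proof
      assume "x = 0"
      then have "(\<Sum>i=1..n. norm (T i x)) = 0" for n
        by (simp add: linear_0[OF linear])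
      with x show False
        by (simp add: absolutely_mean_semi_irregular_def Limsup_const)
    qed
    then have "inj (\<lambda>r::real. r *\<^sub>R x)"
      by (simp add: inj_on_def)
    then have "uncountable ?K"
      using countable_image_inj_eq uncountable_UNIV_real by blast
    moreover have "mean_Li_Yorke_scrambled T ?K"
      unfolding mean_Li_Yorke_scrambled_def pair_iff
    proof (clarify)
      fix r s :: real
      assume "r *\<^sub>R x \<noteq> s *\<^sub>R x"
      then have "r - s \<noteq> 0" by auto
      with x have "absolutely_mean_semi_irregular T ((r - s) *\<^sub>R x)"
        by (intro absolutely_mean_semi_irregular_scaleR linear_scale[OF linear])
      then show "absolutely_mean_semi_irregular T (r *\<^sub>R x - s *\<^sub>R x)"
        by (simp add: scaleR_left_diff_distrib)
    qed
    ultimately show ?thesis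
      unfolding mean_Li_Yorke_chaotic_def by blast
  qed
  moreover have "\<exists>x y. mean_Li_Yorke_pair T x y" if chaotic: "mean_Li_Yorke_chaotic T"
  proof -
    obtain K where K: "uncountable K" "mean_Li_Yorke_scrambled T K"
      using chaotic unfolding mean_Li_Yorke_chaotic_def by blast
    obtain x where "x \<in> K"
      using K(1) by fastforce
    moreover obtain y where "y \<in> K" "y \<noteq> x"
      \<comment> \<open>Without a second point, K would lie in the countable set {x}.\<close>
      using K(1) countable_subset[of K "{x}"] by auto
    ultimately show ?thesis
      using K(2) unfolding mean_Li_Yorke_scrambled_def by blast
  qed
  moreover have "(\<exists>x y. mean_Li_Yorke_pair T x y) \<longleftrightarrow> (\<exists>x. absolutely_mean_semi_irregular T x)"
    \<comment> \<open>A semi-irregular x is paired with 0, since x - 0 = x.\<close>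
    unfolding pair_iff by (metis diff_zero)
  ultimately show ?thesis
    by blast
qed

end
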